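(* Let $A\colon E \supseteq D(A) \to E$ be a densely defined and real linear operator on a complex Banach lattice $E$ and let $u \in E_+$ be a quasi-interior point of $E_+$. Assume that $\lambda_0 \in \sigma(A) \cap \mathbb{R}$ is a pole of the resolvent $\mathcal{R}(\,\cdot\,,A)$ and denote the corresponding spectral projection by $P$. If $\mathcal{R}(\,\cdot\,,A)$ is individually eventually strongly positive with respect to $u$ at $\lambda_0$, or individually eventually strongly negative with respect to $u$ at $\lambda_0$, then $P \gg_u 0$.
   Context: $E_+$ is the positive cone of $E$ and $E_{\mathbb{R}}$ the real part of $E$. For $u \in E_+$ the principal ideal generated by $u$ is $E_u := \{f \in E : \exists c \ge 0,\ |f| \le cu\}$; $u$ is a quasi-interior point of $E_+$ if $E_u$ is dense in $E$. We write $f > 0$ if $f \ge 0$ and $f \ne 0$. For $f \in E_+$ we write $f \gg_u 0$ if there exists $\varepsilon > 0$ such that $f \ge \varepsilon u$. A bounded linear operator $T$ on $E$ is strongly positive with respect to $u$, written $T \gg_u 0$, if $Tf \gg_u 0$ for every $0 < f \in E$. The operator $A$ is real if $D(A) = (E_{\mathbb{R}} \cap D(A)) + i(E_{\mathbb{R}} \cap D(A))$ and $A$ maps $E_{\mathbb{R}} \cap D(A)$ into $E_{\mathbb{R}}$. For $\lambda$ in the resolvent set $\rho(A)$, $\mathcal{R}(\lambda,A) := (\lambda I - A)^{-1}$, an analytic map on $\rho(A)$; $\sigma(A)$ is the spectrum. Let $\lambda_0 \in \mathbb{R} \cap \sigma(A)$ be an isolated spectral value of $A$. The resolvent $\mathcal{R}(\,\cdot\,,A)$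 is called individually eventually strongly positive with respect to $u$ at $\lambda_0$ if, for every $0 < f \in E$, there exists $\lambda_1 > \lambda_0$ such that $(\lambda_0,\lambda_1] \subseteq \rho(A)$ and $\mathcal{R}(\lambda,A)f \gg_u 0$ for all $\lambda \in (\lambda_0,\lambda_1]$. It is called individually eventually strongly negative with respect to $u$ at $\lambda_0$ if, for every $0 < f \in E$, there exists $\lambda_1 < \lambda_0$ such that $[\lambda_1,\lambda_0) \subseteq \rho(A)$ and $-\mathcal{R}(\lambda,A)f \gg_u 0$ for all $\lambda \in [\lambda_1,\lambda_0)$. *)

theory Defs
  imports "HOL-Complex_Analysis.Complex_Analysis" "HOL-Library.Lattice_Algebras" "HOL-Library.Lub_Glb"
begin

section \<open>Real Banach lattices\<close>

class banach_lattice = banach + ordered_real_vector + lattice_ab_group_add_abs +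
  assumes norm_lattice: "\<bar>x\<bar> \<le> \<bar>y\<bar> \<Longrightarrow> norm x \<le> norm y"

instance real :: banach_lattice
  by standard simp

lemma norm_abs_lattice: "norm \<bar>x\<bar> = norm (x::'a::banach_lattice)"
  by (rule antisym) (auto intro!: norm_lattice)

lemma norm_mono_lattice: "0 \<le> x \<Longrightarrow> x \<le> y \<Longrightarrow> norm x \<le> norm (y::'a::banach_lattice)"
  by (rule norm_lattice) (metis abs_of_nonneg order_trans)

lemma abs_scaleR_le: "\<bar>a *\<^sub>R x\<bar> \<le> \<bar>a\<bar> *\<^sub>R \<bar>x::'a::banach_lattice\<bar>"
proof (rule abs_leI)
  have 1: "b *\<^sub>R y \<le> \<bar>b\<bar> *\<^sub>R \<bar>y\<bar>" for b and y :: 'a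
  proof (cases "b \<ge> 0")
    case True
    then show ?thesis by (simp add: scaleR_left_mono abs_ge_self)
  next
    case False
    then have "(-b) *\<^sub>R (-y) \<le> (-b) *\<^sub>R \<bar>y\<bar>"
      by (intro scaleR_left_mono) (auto intro: abs_ge_minus_self)
    with False show ?thesis by simp
  qed
  show "a *\<^sub>R x \<le> \<bar>a\<bar> *\<^sub>R \<bar>x\<bar>" by (rule 1)
  show "- (a *\<^sub>R x) \<le> \<bar>a\<bar> *\<^sub>R \<bar>x\<bar>" using 1[of "-a" x] by simp
qed

lemma banach_lattice_nonneg_limit:
  fixes X :: "nat \<Rightarrow> 'a::banach_lattice"
  assumes lim: "X \<longlonglongrightarrow> x" and pos: "\<And>n. 0 \<le> X n"
  shows "0 \<le> x"
proof -
  have le: "norm (sup (-x) 0) \<le> norm (X n - x)" for n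
  proof (rule norm_lattice)
    have "-x \<le> X n - x" using pos[of n] by simp
    also have "\<dots> \<le> \<bar>X n - x\<bar>" by (rule abs_ge_self)
    finally have "sup (-x) 0 \<le> \<bar>X n - x\<bar>" by simp
    then show "\<bar>sup (-x) 0\<bar> \<le> \<bar>X n - x\<bar>" by simp
  qed
  have "(\<lambda>n. norm (X n - x)) \<longlonglongrightarrow> 0"
    using lim by (simp add: LIM_zero tendsto_norm_zero)
  then have "norm (sup (-x) 0) \<le> 0"
    by (rule LIMSEQ_le_const) (use le in auto)
  then have "sup (-x) 0 = 0" by simp
  then have "-x \<le> 0" by (metis sup.cobounded1)
  then show ?thesis by simp
qed

lemma banach_lattice_le_limit:
  fixes X Y :: "nat \<Rightarrow> 'a::banach_lattice"
  assumes "X \<longlonglongrightarrow> x" "Y \<longlonglongrightarrow> y" "\<And>n. X n \<le> Y n"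
  shows "x \<le> y"
  using banach_lattice_nonneg_limit[OF tendsto_diff[OF assms(2,1)]] assms(3) by simp


section \<open>The complexification of a real Banach lattice\<close>

datatype 'a complexification = Cplx (re: 'a) (im: 'a)

lemma cplx_eq_iff: "z = w \<longleftrightarrow> re z = re w \<and> im z = im w"
  by (cases z; cases w) auto

text \<open>\<^term>\<open>cos t *\<^sub>R re z + sin t *\<^sub>R im z\<close> is the real part of
  \<open>exp (- \<i> t) z\<close>, so the following is the usual modulus
  \<open>|z| = sup {Re (exp (\<i> t) z) | t real}\<close>.\<close>

definition modulus :: "'a::banach_lattice complexification \<Rightarrow> 'a" where
  "modulus z = (THE s. isLub UNIV (range (\<lambda>t::real. cos t *\<^sub>R re z + sin t *\<^sub>R im z)) s)"

lemma isLub_range_iff: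
  "isLub UNIV (range f) s \<longleftrightarrow> (\<forall>t. f t \<le> s) \<and> (\<forall>b. (\<forall>t. f t \<le> b) \<longrightarrow> s \<le> b)"
  by (auto simp: isLub_def leastP_def isUb_def setle_def setge_def)

lemma modulus_exists:
  fixes x y :: "'a::banach_lattice"
  shows "\<exists>s. (\<forall>t::real. cos t *\<^sub>R x + sin t *\<^sub>R y \<le> s) \<and>
             (\<forall>b. (\<forall>t::real. cos t *\<^sub>R x + sin t *\<^sub>R y \<le> b) \<longrightarrow> s \<le> b)"
proof -
  define S where "S t = cos t *\<^sub>R x + sin t *\<^sub>R y" for t :: real
  define e where "e = \<bar>x\<bar> + \<bar>y\<bar>"
  have e0: "0 \<le> e" by (simp add: e_def)
  have lip: "S t \<le> S s + \<bar>t - s\<bar> *\<^sub>R e" for t s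
  proof -
    have c: "\<bar>cos t - cos s\<bar> \<le> \<bar>t - s\<bar>" and d: "\<bar>sin t - sin s\<bar> \<le> \<bar>t - s\<bar>"
    proof -
      have "\<bar>sin ((t - s) / 2)\<bar> \<le> \<bar>t - s\<bar> / 2"
        using abs_sin_x_le_abs_x[of "(t - s)/2"] by simp
      then have h: "\<bar>sin ((t - s) / 2)\<bar> * 2 \<le> \<bar>t - s\<bar>" by simp
      have "\<bar>sin ((t+s)/2)\<bar> * (\<bar>sin ((t - s) / 2)\<bar> * 2) \<le> 1 * \<bar>t - s\<bar>"
        using h by (intro mult_mono) auto
      moreover have "\<bar>cos t - cos s\<bar> = \<bar>sin ((t+s)/2)\<bar> * (\<bar>sin ((t - s) / 2)\<bar> * 2)"
      proof -
        have "\<bar>sin ((s - t) / 2)\<bar> = \<bar>sin ((t - s) / 2)\<bar>"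
          by (metis abs_minus_cancel minus_diff_eq minus_divide_left sin_minus)
        then show ?thesis by (simp add: cos_diff_cos abs_mult)
      qed
      ultimately show "\<bar>cos t - cos s\<bar> \<le> \<bar>t - s\<bar>" by simp
      have "\<bar>cos ((t+s)/2)\<bar> * (\<bar>sin ((t - s) / 2)\<bar> * 2) \<le> 1 * \<bar>t - s\<bar>"
        using h by (intro mult_mono) auto
      then show "\<bar>sin t - sin s\<bar> \<le> \<bar>t - s\<bar>"
        by (simp add: sin_diff_sin abs_mult mult_ac)
    qed
    have "S t - S s = (cos t - cos s) *\<^sub>R x + (sin t - sin s) *\<^sub>R y"
      by (simp add: S_def algebra_simps)
    also have "\<dots> \<le> \<bar>cos t - cos s\<bar> *\<^sub>R \<bar>x\<bar> + \<bar>sin t - sin s\<bar> *\<^sub>R \<bar>y\<bar>"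
      by (intro add_mono order_trans[OF abs_ge_self abs_scaleR_le])
    also have "\<dots> \<le> \<bar>t - s\<bar> *\<^sub>R \<bar>x\<bar> + \<bar>t - s\<bar> *\<^sub>R \<bar>y\<bar>"
      by (intro add_mono scaleR_right_mono c d) auto
    finally show ?thesis by (simp add: e_def algebra_simps)
  qed
  define G where "G n = (\<lambda>k. 2 * pi * real k / real (Suc n)) ` {..n}" for n :: nat
  define F where "F n = Sup_fin (S ` G n)" for n
  define c where "c n = 2 * pi / real (Suc n)" for n :: nat
  have finG: "finite (S ` G n)" "S ` G n \<noteq> {}" for n
    by (auto simp: G_def)
  have c0: "0 \<le> c n" for n by (simp add: c_def)
  have near: "S t \<le> F n + c n *\<^sub>R e" for t n
  proof -
    define t' where "t' = t - 2 * pi * of_int \<lfloor>t / (2 * pi)\<rfloor>"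
    have St: "S t = S t'"
    proof -
      have "t = t' + 2 * pi * of_int \<lfloor>t / (2 * pi)\<rfloor>" by (simp add: t'_def)
      then show ?thesis unfolding S_def
        by (metis sin_cos_eq_iff)
    qed
    have t'b: "0 \<le> t'" "t' < 2 * pi"
    proof -
      show "0 \<le> t'"
        using floor_divide_lower[of "2 * pi" t] by (simp add: t'_def mult.commute)
      show "t' < 2 * pi"
        using floor_divide_upper[of "2 * pi" t] by (simp add: t'_def algebra_simps)
    qed
    define q where "q = t' * real (Suc n) / (2 * pi)"
    define k where "k = nat \<lfloor>q\<rfloor>"
    have q0: "0 \<le> q" using t'b by (simp add: q_def)
    have qn: "q < real (Suc n)"
      using t'b unfolding q_def by (simp add: field_simps del: of_nat_Suc)
    have kq: "real k \<le> q" "q < real k + 1" using q0 by (auto simp: k_def)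
    then have kn: "k \<le> n" using qn by linarith
    define s where "s = 2 * pi * real k / real (Suc n)"
    have sG: "s \<in> G n" using kn by (auto simp: G_def s_def)
    have "t' = q * c n" by (simp add: q_def c_def del: of_nat_Suc)
    moreover have "s = real k * c n" by (simp add: s_def c_def)
    ultimately have "t' - s = (q - real k) * c n" by (simp add: algebra_simps)
    moreover have "\<bar>(q - real k) * c n\<bar> \<le> 1 * c n"
      unfolding abs_mult using kq c0[of n] by (intro mult_mono) auto
    ultimately have ts: "\<bar>t' - s\<bar> \<le> c n" by simp
    have "S t \<le> S s + \<bar>t' - s\<bar> *\<^sub>R e" unfolding St by (rule lip)
    also have "\<dots> \<le> F n + c n *\<^sub>R e"
      unfolding F_def using sG finG ts e0
      by (intro add_mono scaleR_right_mono Sup_fin.coboundedI) auto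
    finally show ?thesis .
  qed
  have Fle: "F n \<le> b" if "\<And>t. S t \<le> b" for n b
    unfolding F_def using finG that by (intro Sup_fin.boundedI) auto
  have FF: "F m - F n \<le> c n *\<^sub>R e" for m n
    using Fle[OF near[of _ n]] by (simp add: algebra_simps)
  have clim: "c \<longlonglongrightarrow> 0" unfolding c_def
    using LIMSEQ_inverse_real_of_nat[THEN tendsto_mult_left, of "2*pi"]
    by (simp add: divide_inverse)
  have "Cauchy F"
  proof (rule metric_CauchyI)
    fix \<epsilon> :: real assume eps: "0 < \<epsilon>"
    have ce: "(\<lambda>n. c n * norm e) \<longlonglongrightarrow> 0" using tendsto_mult_left_zero[OF clim] by simp
    then obtain N where N: "\<And>n. n \<ge> N \<Longrightarrow> c n * norm e < \<epsilon>"
      using order_tendstoD(2)[OF ce eps] unfolding eventually_sequentially by blast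
    have "dist (F m) (F n) < \<epsilon>" if "m \<ge> N" "n \<ge> N" for m n
    proof -
      define d where "d = max (c m) (c n)"
      have "F m - F n \<le> d *\<^sub>R e" "F n - F m \<le> d *\<^sub>R e"
        using FF[of m n] FF[of n m] scaleR_right_mono[OF _ e0, of "c n" d]
          scaleR_right_mono[OF _ e0, of "c m" d]
        by (auto simp: d_def intro: order_trans)
      then have "\<bar>F m - F n\<bar> \<le> d *\<^sub>R e" by (intro abs_leI) auto
      then have "norm (F m - F n) \<le> norm (d *\<^sub>R e)"
        by (metis abs_ge_zero norm_abs_lattice norm_mono_lattice)
      also have "\<dots> = d * norm e" using c0[of m] by (simp add: d_def)
      also have "\<dots> < \<epsilon>" using N that by (auto simp: d_def max_def)
      finally show ?thesis by (simp add: dist_norm)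
    qed
    then show "\<exists>M. \<forall>m\<ge>M. \<forall>n\<ge>M. dist (F m) (F n) < \<epsilon>" by blast
  qed
  then obtain L where L: "F \<longlonglongrightarrow> L"
    using Cauchy_convergent convergent_def by blast
  have "S t \<le> L" for t
  proof (rule banach_lattice_le_limit)
    show "(\<lambda>n. S t) \<longlonglongrightarrow> S t" by simp
    have "(\<lambda>n. F n + c n *\<^sub>R e) \<longlonglongrightarrow> L + 0 *\<^sub>R e"
      by (intro tendsto_intros L clim)
    then show "(\<lambda>n. F n + c n *\<^sub>R e) \<longlonglongrightarrow> L" by simp
  qed (rule near)
  moreover have "L \<le> b" if "\<And>t. S t \<le> b" for b
    by (rule banach_lattice_le_limit[OF L tendsto_const]) (rule Fle[OF that])
  ultimately show ?thesis unfolding S_def by blast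
qed

lemma modulus_unique:
  assumes "\<And>t::real. cos t *\<^sub>R re z + sin t *\<^sub>R im z \<le> s"
    and "\<And>b. (\<And>t::real. cos t *\<^sub>R re z + sin t *\<^sub>R im z \<le> b) \<Longrightarrow> s \<le> b"
  shows "modulus z = s"
  unfolding modulus_def isLub_range_iff
  by (rule the_equality) (use assms in \<open>blast intro: antisym\<close>)+

lemma modulus_upper_least:
  "(\<forall>t::real. cos t *\<^sub>R re z + sin t *\<^sub>R im z \<le> modulus z) \<and>
   (\<forall>b. (\<forall>t::real. cos t *\<^sub>R re z + sin t *\<^sub>R im z \<le> b) \<longrightarrow> modulus z \<le> b)"
proof -
  obtain s where s: "\<forall>t::real. cos t *\<^sub>R re z + sin t *\<^sub>R im z \<le> s"
    "\<forall>b. (\<forall>t::real. cos t *\<^sub>R re z + sin t *\<^sub>R im z \<le> b) \<longrightarrow> s \<le> b"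
    using modulus_exists by blast
  then have "modulus z = s" by (intro modulus_unique) auto
  with s show ?thesis by simp
qed

lemma modulus_upper: "cos t *\<^sub>R re z + sin t *\<^sub>R im z \<le> modulus z"
  using modulus_upper_least by blast

lemma modulus_least:
  "(\<And>t::real. cos t *\<^sub>R re z + sin t *\<^sub>R im z \<le> b) \<Longrightarrow> modulus z \<le> b"
  using modulus_upper_least by blast

lemma abs_re_le_modulus: "\<bar>re z\<bar> \<le> modulus z"
  using modulus_upper[of 0 z] modulus_upper[of pi z] by (intro abs_leI) auto

lemma abs_im_le_modulus: "\<bar>im z\<bar> \<le> modulus z"
  using modulus_upper[of "pi/2" z] modulus_upper[of "-pi/2" z] by (intro abs_leI) auto

lemma modulus_nonneg: "0 \<le> modulus z"
  using abs_re_le_modulus abs_ge_zero order_trans by blast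

lemma modulus_le: "modulus z \<le> \<bar>re z\<bar> + \<bar>im z\<bar>"
proof (rule modulus_least)
  fix t :: real
  have "cos t *\<^sub>R re z + sin t *\<^sub>R im z \<le> \<bar>cos t\<bar> *\<^sub>R \<bar>re z\<bar> + \<bar>sin t\<bar> *\<^sub>R \<bar>im z\<bar>"
    by (intro add_mono order_trans[OF abs_ge_self abs_scaleR_le])
  also have "\<dots> \<le> 1 *\<^sub>R \<bar>re z\<bar> + 1 *\<^sub>R \<bar>im z\<bar>"
    by (intro add_mono scaleR_right_mono) auto
  finally show "cos t *\<^sub>R re z + sin t *\<^sub>R im z \<le> \<bar>re z\<bar> + \<bar>im z\<bar>" by simp
qed

lemma modulus_real: "modulus (Cplx x 0) = \<bar>x\<bar>"
  using abs_re_le_modulus[of "Cplx x 0"] modulus_le[of "Cplx x 0"] by (simp add: antisym)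

instantiation complexification :: (banach_lattice) real_vector
begin

definition "0 = Cplx 0 0"
definition "z + w = Cplx (re z + re w) (im z + im w)"
definition "z - w = Cplx (re z - re w) (im z - im w)"
definition "- z = Cplx (- re z) (- im z)"
definition "a *\<^sub>R z = Cplx (a *\<^sub>R re z) (a *\<^sub>R im z)"
lemma re_im_simps [simp]:
  "re (0::'a complexification) = 0" "im (0::'a complexification) = 0"
  "re (z + w) = re z + re w" "im (z + w) = im z + im w"
  "re (z - w) = re z - re w" "im (z - w) = im z - im w"
  "re (- z) = - re z" "im (- z) = - im z"
  "re (a *\<^sub>R z) = a *\<^sub>R re z" "im (a *\<^sub>R z) = a *\<^sub>R im z"
  for z w :: "'a complexification"
  by (simp_all add: zero_complexification_def plus_complexification_def
      minus_complexification_def uminus_complexification_def scaleR_complexification_def)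

instance
proof
  fix z w v :: "'a complexification" and a b :: real
  show "z + w + v = z + (w + v)" by (simp add: cplx_eq_iff algebra_simps)
  show "z + w = w + z" by (simp add: cplx_eq_iff algebra_simps)
  show "0 + z = z" by (simp add: cplx_eq_iff)
  show "- z + z = 0" by (simp add: cplx_eq_iff)
  show "z - w = z + - w" by (simp add: cplx_eq_iff)
  show "a *\<^sub>R (z + w) = a *\<^sub>R z + a *\<^sub>R w" by (simp add: cplx_eq_iff algebra_simps)
  show "(a + b) *\<^sub>R z = a *\<^sub>R z + b *\<^sub>R z" by (simp add: cplx_eq_iff algebra_simps)
  show "a *\<^sub>R b *\<^sub>R z = (a * b) *\<^sub>R z" by (simp add: cplx_eq_iff)
  show "1 *\<^sub>R z = z" by (simp add: cplx_eq_iff)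
qed

end

instantiation complexification :: (banach_lattice) real_normed_vector
begin

definition norm_complexification_def: "norm z = norm (modulus z)"
definition sgn_complexification_def:
  "sgn (z::'a complexification) = z /\<^sub>R norm z"
definition dist_complexification_def:
  "dist (z::'a complexification) w = norm (z - w)"
definition uniformity_complexification_def [code del]:
  "(uniformity :: ('a complexification \<times> 'a complexification) filter) =
     (INF e\<in>{0 <..}. principal {(x, y). dist x y < e})"
definition open_complexification_def [code del]:
  "open (U :: 'a complexification set) \<longleftrightarrow>
     (\<forall>x\<in>U. eventually (\<lambda>(x', y). x' = x \<longrightarrow> y \<in> U) uniformity)"

lemma norm_re_le: "norm (re z) \<le> norm (z::'a complexification)"
  unfolding norm_complexification_def
  by (metis abs_re_le_modulus abs_ge_zero norm_abs_lattice norm_mono_lattice)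

lemma norm_im_le: "norm (im z) \<le> norm (z::'a complexification)"
  unfolding norm_complexification_def
  by (metis abs_im_le_modulus abs_ge_zero norm_abs_lattice norm_mono_lattice)

lemma norm_le_re_im: "norm (z::'a complexification) \<le> norm (re z) + norm (im z)"
proof -
  have "norm z \<le> norm (\<bar>re z\<bar> + \<bar>im z\<bar>)"
    unfolding norm_complexification_def by (intro norm_mono_lattice modulus_nonneg modulus_le)
  also have "\<dots> \<le> norm (re z) + norm (im z)"
    by (metis norm_abs_lattice norm_triangle_ineq)
  finally show ?thesis .
qed

lemma modulus_add: "modulus (z + w) \<le> modulus z + modulus (w::'a complexification)"
proof (rule modulus_least)
  fix t :: real
  have "cos t *\<^sub>R re (z + w) + sin t *\<^sub>R im (z + w) =
    (cos t *\<^sub>R re z + sin t *\<^sub>R im z) + (cos t *\<^sub>R re w + sin t *\<^sub>R im w)"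
    by (simp add: algebra_simps)
  also have "\<dots> \<le> modulus z + modulus w" by (intro add_mono modulus_upper)
  finally show "cos t *\<^sub>R re (z + w) + sin t *\<^sub>R im (z + w) \<le> modulus z + modulus w" .
qed

lemma modulus_polar:
  fixes z w :: "'a complexification"
  assumes r: "0 \<le> r" and re: "re w = (r * cos a) *\<^sub>R re z - (r * sin a) *\<^sub>R im z"
    and im: "im w = (r * sin a) *\<^sub>R re z + (r * cos a) *\<^sub>R im z"
  shows "modulus w = r *\<^sub>R modulus z"
proof (cases "r = 0")
  case True
  have "\<bar>re w\<bar> + \<bar>im w\<bar> = 0" using re im True by simp
  then have "modulus w = 0" using modulus_le[of w] modulus_nonneg[of w] by (simp add: antisym)
  with True show ?thesis by simp
next
  case False
  with r have r: "0 < r" by simp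
  have *: "cos t *\<^sub>R re w + sin t *\<^sub>R im w =
      r *\<^sub>R (cos (t - a) *\<^sub>R re z + sin (t - a) *\<^sub>R im z)" for t
    unfolding re im by (simp add: cos_diff sin_diff algebra_simps)
  show ?thesis
  proof (rule modulus_unique)
    show "cos t *\<^sub>R re w + sin t *\<^sub>R im w \<le> r *\<^sub>R modulus z" for t
      unfolding * using r by (intro scaleR_left_mono modulus_upper) auto
    fix b assume b: "\<And>t::real. cos t *\<^sub>R re w + sin t *\<^sub>R im w \<le> b"
    have "modulus z \<le> inverse r *\<^sub>R b"
    proof (rule modulus_least)
      fix t :: real
      have "inverse r *\<^sub>R (r *\<^sub>R (cos t *\<^sub>R re z + sin t *\<^sub>R im z)) \<le> inverse r *\<^sub>R b"
        using b[of "t + a", unfolded *] r by (intro scaleR_left_mono) auto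
      then show "cos t *\<^sub>R re z + sin t *\<^sub>R im z \<le> inverse r *\<^sub>R b" using r by simp
    qed
    then have "r *\<^sub>R modulus z \<le> r *\<^sub>R (inverse r *\<^sub>R b)" using r by (intro scaleR_left_mono) auto
    then show "r *\<^sub>R modulus z \<le> b" using r by simp
  qed
qed

instance
proof
  fix z w v :: "'a complexification" and a b :: real and S :: "'a complexification set"
  show "dist z w = norm (z - w)" by (rule dist_complexification_def)
  show "sgn z = z /\<^sub>R norm z" by (rule sgn_complexification_def)
  show "(uniformity :: ('a complexification \<times> 'a complexification) filter) =
     (INF e\<in>{0 <..}. principal {(x, y). dist x y < e})"
    by (rule uniformity_complexification_def)
  show "open S \<longleftrightarrow> (\<forall>x\<in>S. eventually (\<lambda>(x', y). x' = x \<longrightarrow> y \<in> S) uniformity)"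
    by (rule open_complexification_def)
  show "(norm z = 0) = (z = 0)"
  proof
    assume "norm z = 0"
    then show "z = 0" using norm_re_le[of z] norm_im_le[of z] by (simp add: cplx_eq_iff)
  next
    assume "z = 0"
    then show "norm z = 0" using norm_le_re_im[of z]
      by (simp add: norm_complexification_def)
  qed
  have "norm (modulus (z + w)) \<le> norm (modulus z + modulus w)"
    by (intro norm_mono_lattice modulus_nonneg modulus_add)
  also have "\<dots> \<le> norm (modulus z) + norm (modulus w)" by (rule norm_triangle_ineq)
  finally show "norm (z + w) \<le> norm z + norm w" by (simp add: norm_complexification_def)
  have "modulus (a *\<^sub>R z) = \<bar>a\<bar> *\<^sub>R modulus z"
    by (rule modulus_polar[where a = "if 0 \<le> a then 0 else pi"]) auto
  then show "norm (a *\<^sub>R z) = \<bar>a\<bar> * norm z" by (simp add: norm_complexification_def)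
qed

end

instance complexification :: (banach_lattice) banach
proof
  fix X :: "nat \<Rightarrow> 'a complexification"
  assume "Cauchy X"
  then have C: "\<And>e. e > 0 \<Longrightarrow> \<exists>M. \<forall>m\<ge>M. \<forall>n\<ge>M. norm (X m - X n) < e"
    by (rule CauchyD)
  have "Cauchy (\<lambda>n. re (X n))"
  proof (rule CauchyI)
    fix e :: real assume "0 < e"
    from C[OF this] obtain M where "\<forall>m\<ge>M. \<forall>n\<ge>M. norm (X m - X n) < e" by blast
    then show "\<exists>M. \<forall>m\<ge>M. \<forall>n\<ge>M. norm (re (X m) - re (X n)) < e"
      by (metis norm_re_le re_im_simps(5) le_less_trans)
  qed
  then obtain x where x: "(\<lambda>n. re (X n)) \<longlonglongrightarrow> x"
    using Cauchy_convergent convergent_def by blast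
  have "Cauchy (\<lambda>n. im (X n))"
  proof (rule CauchyI)
    fix e :: real assume "0 < e"
    from C[OF this] obtain M where "\<forall>m\<ge>M. \<forall>n\<ge>M. norm (X m - X n) < e" by blast
    then show "\<exists>M. \<forall>m\<ge>M. \<forall>n\<ge>M. norm (im (X m) - im (X n)) < e"
      by (metis norm_im_le re_im_simps(6) le_less_trans)
  qed
  then obtain y where y: "(\<lambda>n. im (X n)) \<longlonglongrightarrow> y"
    using Cauchy_convergent convergent_def by blast
  have "(\<lambda>n. norm (re (X n) - x) + norm (im (X n) - y)) \<longlonglongrightarrow> 0 + 0"
    by (intro tendsto_add tendsto_norm_zero LIM_zero x y)
  then have lim: "(\<lambda>n. norm (re (X n) - x) + norm (im (X n) - y)) \<longlonglongrightarrow> 0" by simp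
  have le: "norm (X n - Cplx x y) \<le> norm (re (X n) - x) + norm (im (X n) - y)" for n
    using norm_le_re_im[of "X n - Cplx x y"] by simp
  have "(\<lambda>n. X n - Cplx x y) \<longlonglongrightarrow> 0"
    by (rule Lim_null_comparison[OF _ lim]) (use le in auto)
  then show "convergent X" unfolding convergent_def using LIM_zero_cancel by blast
qed

text \<open>The order has \<open>E\<^sub>+ = {f. 0 \<le> f}\<close> equal to the positive cone of the real part.\<close>

instantiation complexification :: (banach_lattice) ordered_real_vector
begin

definition less_eq_complexification_def: "z \<le> w \<longleftrightarrow> re z \<le> re w \<and> im z = im w"
definition less_complexification_def:
  "z < w \<longleftrightarrow> z \<le> w \<and> z \<noteq> (w :: 'a complexification)"

instance
proof
  fix z w v :: "'a complexification" and a b :: real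
  note defs = less_eq_complexification_def less_complexification_def cplx_eq_iff
  show "z < w \<longleftrightarrow> z \<le> w \<and> \<not> w \<le> z" by (auto simp: defs)
  show "z \<le> z" by (simp add: defs)
  show "z \<le> w \<Longrightarrow> w \<le> v \<Longrightarrow> z \<le> v" by (auto simp: defs)
  show "z \<le> w \<Longrightarrow> w \<le> z \<Longrightarrow> z = w" by (simp add: defs)
  show "z \<le> w \<Longrightarrow> v + z \<le> v + w" by (simp add: defs)
  show "z \<le> w \<Longrightarrow> 0 \<le> a \<Longrightarrow> a *\<^sub>R z \<le> a *\<^sub>R w" by (simp add: defs scaleR_left_mono)
  show "a \<le> b \<Longrightarrow> 0 \<le> z \<Longrightarrow> a *\<^sub>R z \<le> b *\<^sub>R z"
    by (auto simp: less_eq_complexification_def scaleR_right_mono dest: sym)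
qed

end

instantiation complexification :: (banach_lattice) abs
begin

definition abs_complexification_def: "\<bar>z\<bar> = Cplx (modulus z) 0"

instance ..

end

definition scaleC :: "complex \<Rightarrow> 'a::banach_lattice complexification \<Rightarrow> 'a complexification"
    (infixr \<open>*\<^sub>C\<close> 75) where
  "c *\<^sub>C z = Cplx (Re c *\<^sub>R re z - Im c *\<^sub>R im z) (Re c *\<^sub>R im z + Im c *\<^sub>R re z)"

global_interpretation cplx: vector_space "scaleC"
proof
  fix a b :: complex and x y :: "'a complexification"
  show "a *\<^sub>C (x + y) = a *\<^sub>C x + a *\<^sub>C y" by (simp add: scaleC_def cplx_eq_iff algebra_simps)
  show "(a + b) *\<^sub>C x = a *\<^sub>C x + b *\<^sub>C x" by (simp add: scaleC_def cplx_eq_iff algebra_simps)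
  show "a *\<^sub>C b *\<^sub>C x = (a * b) *\<^sub>C x" by (simp add: scaleC_def cplx_eq_iff algebra_simps)
  show "1 *\<^sub>C x = x" by (simp add: scaleC_def cplx_eq_iff)
qed

lemma scaleC_of_real: "complex_of_real a *\<^sub>C z = a *\<^sub>R z"
  by (simp add: scaleC_def cplx_eq_iff)

lemma cplx_decomp: "z = Cplx (re z) 0 + \<i> *\<^sub>C Cplx (im z) 0"
  by (simp add: scaleC_def cplx_eq_iff)

lemma modulus_scaleC: "modulus (c *\<^sub>C z) = cmod c *\<^sub>R modulus z"
proof (rule modulus_polar[where a = "Arg c"])
  have "c = rcis (cmod c) (Arg c)" by (simp add: rcis_cmod_Arg)
  then have "Re c = cmod c * cos (Arg c)" "Im c = cmod c * sin (Arg c)"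
    by (metis Re_rcis, metis Im_rcis)
  then show "re (c *\<^sub>C z) = (cmod c * cos (Arg c)) *\<^sub>R re z - (cmod c * sin (Arg c)) *\<^sub>R im z"
    "im (c *\<^sub>C z) = (cmod c * sin (Arg c)) *\<^sub>R re z + (cmod c * cos (Arg c)) *\<^sub>R im z"
    by (simp_all add: scaleC_def)
qed simp

lemma norm_scaleC: "norm (c *\<^sub>C z) = cmod c * norm z"
  by (simp add: norm_complexification_def modulus_scaleC)

definition real_part :: "'a::banach_lattice complexification set" where
  "real_part = {f. im f = 0}"


section \<open>Quasi-interior points and strong positivity\<close>

definition principal_ideal ::
    "'a::banach_lattice complexification \<Rightarrow> 'a complexification set" where
  "principal_ideal u = {f. \<exists>c\<ge>0. \<bar>f\<bar> \<le> c *\<^sub>R u}"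

definition quasi_interior_point :: "'a::banach_lattice complexification \<Rightarrow> bool" where
  "quasi_interior_point u \<longleftrightarrow> 0 \<le> u \<and> closure (principal_ideal u) = UNIV"

definition strongly_positive_vec ::
    "'a::banach_lattice complexification \<Rightarrow> 'a complexification \<Rightarrow> bool" where
  "strongly_positive_vec u f \<longleftrightarrow> 0 \<le> f \<and> (\<exists>\<epsilon>>0. \<epsilon> *\<^sub>R u \<le> f)"

definition bounded_clinear ::
    "('a::banach_lattice complexification \<Rightarrow> 'a complexification) \<Rightarrow> bool" where
  "bounded_clinear T \<longleftrightarrow> Vector_Spaces.linear scaleC scaleC T \<and> bounded_linear T"

definition strongly_positive_op ::
    "'a::banach_lattice complexification \<Rightarrow>
     ('a complexification \<Rightarrow> 'a complexification) \<Rightarrow> bool" where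
  "strongly_positive_op u T \<longleftrightarrow>
     bounded_clinear T \<and> (\<forall>f>0. strongly_positive_vec u (T f))"


section \<open>Unbounded operators and their resolvents\<close>

text \<open>An operator with domain \<^term>\<open>D\<close> is given by \<^term>\<open>D\<close> and a total function
  whose values outside \<^term>\<open>D\<close> are irrelevant.\<close>

definition linear_operator ::
    "'a::banach_lattice complexification set \<Rightarrow>
     ('a complexification \<Rightarrow> 'a complexification) \<Rightarrow> bool" where
  "linear_operator D A \<longleftrightarrow> cplx.subspace D \<and>
     (\<forall>f\<in>D. \<forall>g\<in>D. A (f + g) = A f + A g) \<and> (\<forall>c. \<forall>f\<in>D. A (c *\<^sub>C f) = c *\<^sub>C A f)"

definition real_operator ::
    "'a::banach_lattice complexification set \<Rightarrow>
     ('a complexification \<Rightarrow> 'a complexification) \<Rightarrow> bool" where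
  "real_operator D A \<longleftrightarrow>
     D = {f + \<i> *\<^sub>C g | f g. f \<in> real_part \<inter> D \<and> g \<in> real_part \<inter> D} \<and>
     A ` (real_part \<inter> D) \<subseteq> real_part"

definition resolvent ::
    "'a::banach_lattice complexification set \<Rightarrow>
     ('a complexification \<Rightarrow> 'a complexification) \<Rightarrow> complex \<Rightarrow>
     'a complexification \<Rightarrow> 'a complexification" where
  "resolvent D A \<mu> = inv_into D (\<lambda>f. \<mu> *\<^sub>C f - A f)"

definition resolvent_set ::
    "'a::banach_lattice complexification set \<Rightarrow>
     ('a complexification \<Rightarrow> 'a complexification) \<Rightarrow> complex set" where
  "resolvent_set D A =
     {\<mu>. bij_betw (\<lambda>f. \<mu> *\<^sub>C f - A f) D UNIV \<and> bounded_clinear (resolvent D A \<mu>)}"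

definition spectrum ::
    "'a::banach_lattice complexification set \<Rightarrow>
     ('a complexification \<Rightarrow> 'a complexification) \<Rightarrow> complex set" where
  "spectrum D A = - resolvent_set D A"

text \<open>A pole is an isolated singularity at which the Laurent expansion of the resolvent, convergent
  in operator norm, has a finite nonzero principal part; \<^term>\<open>m\<close> is the order of the pole and
  \<^term>\<open>U k\<close> the coefficient of the power \<open>k - m\<close>. The library predicate
  \<^const>\<open>is_pole\<close> (norm tending to infinity) is not usable here: in infinite dimension
  it also holds at some essential singularities.\<close>

definition resolvent_pole ::
    "'a::banach_lattice complexification set \<Rightarrow>
     ('a complexification \<Rightarrow> 'a complexification) \<Rightarrow> complex \<Rightarrow> bool" where
  "resolvent_pole D A \<mu>\<^sub>0 \<longleftrightarrow>
     (\<exists>m::nat. \<exists>r::real. \<exists>U. m > 0 \<and> r > 0 \<and> (\<forall>k. bounded_clinear (U k)) \<and> U 0 \<noteq> (\<lambda>f. 0) \<and>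
        (\<forall>\<mu>\<in>ball \<mu>\<^sub>0 r - {\<mu>\<^sub>0}. \<mu> \<in> resolvent_set D A \<and>
           (\<lambda>N. onorm (\<lambda>f. resolvent D A \<mu> f -
              (\<Sum>k<N. ((\<mu> - \<mu>\<^sub>0) powi (int k - int m)) *\<^sub>C U k f))) \<longlonglongrightarrow> 0))"

text \<open>The integral over the positively oriented circle, for functions with values in the
  Banach space \<open>E\<close>.\<close>

definition circle_integral ::
    "complex \<Rightarrow> real \<Rightarrow> (complex \<Rightarrow> 'a::banach_lattice complexification) \<Rightarrow>
     'a complexification" where
  "circle_integral z r g = integral {0..2 * pi} (\<lambda>t. (\<i> * r * cis t) *\<^sub>C g (z + r * cis t))"

text \<open>\<open>P = 1 / (2 \<pi> \<i>) \<integral> R(\<mu>, A) d\<mu>\<close> over a sufficiently small circle around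
  \<open>\<mu>\<^sub>0\<close>; by Cauchy's theorem the integral takes the same value for all small radii, and this
  common value is the one selected. Since the resolvent is continuous in operator norm on the
  circle, the operator-valued integral may be evaluated pointwise.\<close>

definition spectral_projection ::
    "'a::banach_lattice complexification set \<Rightarrow>
     ('a complexification \<Rightarrow> 'a complexification) \<Rightarrow> complex \<Rightarrow>
     'a complexification \<Rightarrow> 'a complexification" where
  "spectral_projection D A \<mu>\<^sub>0 f =
     (THE y. \<forall>\<^sub>F r in at_right (0::real).
        y = (1 / (2 * pi * \<i>)) *\<^sub>C circle_integral \<mu>\<^sub>0 r (\<lambda>\<mu>. resolvent D A \<mu> f))"


section \<open>Individual eventual strong positivity and negativity of the resolvent\<close>

definition resolvent_ev_strongly_positive ::
    "'a::banach_lattice complexification set \<Rightarrow>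
     ('a complexification \<Rightarrow> 'a complexification) \<Rightarrow> 'a complexification \<Rightarrow> real \<Rightarrow> bool" where
  "resolvent_ev_strongly_positive D A u \<mu>\<^sub>0 \<longleftrightarrow>
     (\<forall>f>0. \<exists>\<mu>\<^sub>1>\<mu>\<^sub>0. complex_of_real ` {\<mu>\<^sub>0<..\<mu>\<^sub>1} \<subseteq> resolvent_set D A \<and>
        (\<forall>\<mu>\<in>{\<mu>\<^sub>0<..\<mu>\<^sub>1}. strongly_positive_vec u (resolvent D A (complex_of_real \<mu>) f)))"

definition resolvent_ev_strongly_negative ::
    "'a::banach_lattice complexification set \<Rightarrow>
     ('a complexification \<Rightarrow> 'a complexification) \<Rightarrow> 'a complexification \<Rightarrow> real \<Rightarrow> bool" where
  "resolvent_ev_strongly_negative D A u \<mu>\<^sub>0 \<longleftrightarrow>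
     (\<forall>f>0. \<exists>\<mu>\<^sub>1<\<mu>\<^sub>0. complex_of_real ` {\<mu>\<^sub>1..<\<mu>\<^sub>0} \<subseteq> resolvent_set D A \<and>
        (\<forall>\<mu>\<in>{\<mu>\<^sub>1..<\<mu>\<^sub>0}. strongly_positive_vec u (- resolvent D A (complex_of_real \<mu>) f)))"

end

theory Submission
  imports Defs
begin

text \<open>
  Let \<open>m\<close> be the order of the pole and \<open>U\<close> the coefficient of \<open>(\<mu> - \<mu>\<^sub>0)\<close> to the power \<open>- m\<close> in
  the Laurent expansion of the resolvent, so that \<open>(\<mu> - \<mu>\<^sub>0) ^ m\<close> times \<open>R(\<mu>, A) f\<close> tends to
  \<open>U f\<close> as \<open>\<mu>\<close> tends to \<open>\<mu>\<^sub>0\<close>. All algebraic properties of \<open>U\<close> that matter come from passing to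
  this limit (\<open>leading_coeff_limit\<close>) in the resolvent identity: \<open>U\<close> commutes with the resolvent, its values are
  eigenvectors, \<open>R(\<lambda>, A) U f = (\<lambda> - \<mu>\<^sub>0)\<inverse> U f\<close> (\<open>resolvent_leading_coeff\<close>), and therefore
  \<open>U \<circ> U = 0\<close> if \<open>m \<ge> 2\<close> (\<open>leading_coeff_square\<close>).

  Approaching \<open>\<mu>\<^sub>0\<close> along the real axis from the side where the resolvent has a sign shows that
  \<open>V = \<plusminus> U\<close> is a positive operator. It is even strictly positive (\<open>V_pos\<close>): if \<open>V f = 0\<close> for some
  \<open>f > 0\<close>, then \<open>V\<close> also kills \<open>R(\<lambda>, A) f\<close>, which up to sign dominates a multiple of \<open>u\<close>; by
  positivity \<open>V u = 0\<close>, so \<open>V\<close> vanishes on the principal ideal of \<open>u\<close>, hence everywhere by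
  density, contradicting the choice of \<open>m\<close>. Strict positivity excludes \<open>V \<circ> V = 0\<close>, so \<open>m = 1\<close>,
  and \<open>U\<close> is the residue of the resolvent, that is, the spectral projection
  (\<open>spectral_projection_eq_residue\<close>). Finally \<open>V f > 0\<close> is
  an eigenvector, so the assumption applied to \<open>V f\<close> in place of \<open>f\<close> says that a positive
  multiple of \<open>V f\<close>, hence \<open>V f\<close> itself, dominates a multiple of \<open>u\<close>.

  With the sign \<open>s = 1\<close> for eventual positivity and \<open>s = - 1\<close> for eventual negativity both cases are
  treated at once; the sign that makes \<open>U\<close> positive is then \<open>s ^ (m + 1)\<close>, which is \<open>1\<close> for
  \<open>m = 1\<close>.
\<close>

section \<open>Complex scaling and limits in the complexification\<close>

lemma bounded_bilinear_scaleC: "bounded_bilinear scaleC"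
proof
  fix a b :: complex and x y :: "'a complexification" and t :: real
  show "(a + b) *\<^sub>C x = a *\<^sub>C x + b *\<^sub>C x" by (rule cplx.scale_left_distrib)
  show "a *\<^sub>C (x + y) = a *\<^sub>C x + a *\<^sub>C y" by (rule cplx.scale_right_distrib)
  show "(t *\<^sub>R a) *\<^sub>C x = t *\<^sub>R (a *\<^sub>C x)" by (simp add: scaleC_def cplx_eq_iff algebra_simps)
  show "a *\<^sub>C (t *\<^sub>R x) = t *\<^sub>R (a *\<^sub>C x)" by (simp add: scaleC_def cplx_eq_iff algebra_simps)
  show "\<exists>K. \<forall>(a::complex) x::'a complexification. norm (a *\<^sub>C x) \<le> norm a * norm x * K"
    by (rule exI[of _ 1]) (simp add: norm_scaleC)
qed

lemmas tendsto_scaleC = bounded_bilinear.tendsto[OF bounded_bilinear_scaleC]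

lemma bounded_linear_re: "bounded_linear (re :: 'a::banach_lattice complexification \<Rightarrow> 'a)"
  by (rule bounded_linear_intro[where K = 1]) (auto simp: norm_re_le)

lemma bounded_linear_im: "bounded_linear (im :: 'a::banach_lattice complexification \<Rightarrow> 'a)"
  by (rule bounded_linear_intro[where K = 1]) (auto simp: norm_im_le)

lemma closed_nonneg_complexification: "closed {z :: 'a::banach_lattice complexification. 0 \<le> z}"
  unfolding closed_sequential_limits
proof (intro allI impI, elim conjE)
  fix X and z :: "'a complexification"
  assume X: "\<forall>n. X n \<in> {z. 0 \<le> z}" and lim: "X \<longlonglongrightarrow> z"
  have re: "0 \<le> re (X n)" and im: "im (X n) = 0" for n
    using X by (auto simp: less_eq_complexification_def dest: spec[of _ n])
  have "0 \<le> re z"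
    by (rule banach_lattice_nonneg_limit[OF bounded_linear.tendsto[OF bounded_linear_re lim] re])
  moreover have "im z = 0"
    using bounded_linear.tendsto[OF bounded_linear_im lim] unfolding im LIMSEQ_const_iff by (rule sym)
  ultimately show "z \<in> {z. 0 \<le> z}" by (simp add: less_eq_complexification_def)
qed

lemma bounded_clinear_scaleC:
  assumes "bounded_clinear T" shows "T (c *\<^sub>C x) = c *\<^sub>C T x"
  using assms unfolding bounded_clinear_def
  by (auto simp: Vector_Spaces.linear_def module_hom_def module_hom_axioms_def)

lemma bounded_clinear_bounded_linear: "bounded_clinear T \<Longrightarrow> bounded_linear T"
  by (simp add: bounded_clinear_def)

lemma bounded_linear_scaleC_comp: "bounded_linear T \<Longrightarrow> bounded_linear (\<lambda>x. c *\<^sub>C T x)"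
  using bounded_linear_compose bounded_bilinear.bounded_linear_right[OF bounded_bilinear_scaleC]
  by blast


section \<open>The resolvent identity\<close>

text \<open>The vector \<open>g = R(k, A) f\<close> satisfies \<open>(l - A) g = f + (l - k) g\<close>; apply \<open>R(l, A)\<close> to both
  sides.\<close>

lemma resolvent_identity:
  assumes l: "l \<in> resolvent_set D A" and k: "k \<in> resolvent_set D A"
  shows "resolvent D A k f - resolvent D A l f = (l - k) *\<^sub>C resolvent D A l (resolvent D A k f)"
proof -
  define g where "g = resolvent D A k f"
  have bk: "bij_betw (\<lambda>f. k *\<^sub>C f - A f) D UNIV" and bl: "bij_betw (\<lambda>f. l *\<^sub>C f - A f) D UNIV"
    and cl: "bounded_clinear (resolvent D A l)"
    using l k by (auto simp: resolvent_set_def)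
  have gD: "g \<in> D"
    unfolding g_def resolvent_def using bk by (metis UNIV_I bij_betw_def inv_into_into)
  have kg: "k *\<^sub>C g - A g = f"
    unfolding g_def resolvent_def using bk by (metis (mono_tags, lifting) UNIV_I bij_betw_def f_inv_into_f)
  have "l *\<^sub>C g - A g = f + (l - k) *\<^sub>C g"
    unfolding kg[symmetric] by (simp add: cplx.scale_left_diff_distrib)
  moreover have "resolvent D A l (l *\<^sub>C g - A g) = g"
    unfolding resolvent_def using bl gD bij_betw_inv_into_left by fastforce
  ultimately have "g = resolvent D A l f + (l - k) *\<^sub>C resolvent D A l g"
    using bounded_clinear_scaleC[OF cl] bounded_clinear_bounded_linear[OF cl]
    by (metis bounded_linear.linear linear_add)
  then show ?thesis by (simp add: g_def algebra_simps)
qed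

lemma resolvent_commute:
  assumes l: "l \<in> resolvent_set D A" and k: "k \<in> resolvent_set D A"
  shows "resolvent D A k (resolvent D A l f) = resolvent D A l (resolvent D A k f)"
proof (cases "k = l")
  case False
  have "(l - k) *\<^sub>C resolvent D A l (resolvent D A k f)
      = (l - k) *\<^sub>C resolvent D A k (resolvent D A l f)"
    using resolvent_identity[OF l k, of f] resolvent_identity[OF k l, of f]
    by (metis cplx.scale_minus_left minus_diff_eq)
  then show ?thesis using False by simp
qed simp


section \<open>The Laurent expansion of the resolvent at a pole\<close>

locale resolvent_laurent =
  fixes D :: "'a::banach_lattice complexification set"
    and A :: "'a complexification \<Rightarrow> 'a complexification"
    and \<mu>\<^sub>0 :: complex and m :: nat and r :: real
    and U :: "nat \<Rightarrow> 'a complexification \<Rightarrow> 'a complexification"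
  assumes r_pos: "r > 0"
    and coeff: "bounded_clinear (U k)"
    and in_resolvent_set: "\<mu> \<in> ball \<mu>\<^sub>0 r - {\<mu>\<^sub>0} \<Longrightarrow> \<mu> \<in> resolvent_set D A"
    and expansion: "\<mu> \<in> ball \<mu>\<^sub>0 r - {\<mu>\<^sub>0} \<Longrightarrow>
      (\<lambda>N. onorm (\<lambda>f. resolvent D A \<mu> f -
         (\<Sum>k<N. ((\<mu> - \<mu>\<^sub>0) powi (int k - int m)) *\<^sub>C U k f))) \<longlonglongrightarrow> 0"
begin

lemma shifted_in_resolvent_set:
  assumes "z \<noteq> 0" "cmod z < r" shows "\<mu>\<^sub>0 + z \<in> resolvent_set D A"
  using assms by (intro in_resolvent_set) (auto simp: dist_norm)

lemma resolvent_bounded_clinear: "l \<in> resolvent_set D A \<Longrightarrow> bounded_clinear (resolvent D A l)"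
  by (simp add: resolvent_set_def)

lemma resolvent_sums:
  assumes z: "z \<noteq> 0" "cmod z < r"
  shows "(\<lambda>k. (z powi (int k - int m)) *\<^sub>C U k f) sums resolvent D A (\<mu>\<^sub>0 + z) f"
proof -
  let ?E = "\<lambda>N f. resolvent D A (\<mu>\<^sub>0 + z) f - (\<Sum>k<N. (z powi (int k - int m)) *\<^sub>C U k f)"
  have bl: "bounded_linear (?E N)" for N
    using resolvent_bounded_clinear[OF shifted_in_resolvent_set[OF z]] coeff
    by (intro bounded_linear_sub bounded_linear_sum bounded_linear_scaleC_comp
        bounded_clinear_bounded_linear)
  have "(\<lambda>N. onorm (?E N)) \<longlonglongrightarrow> 0"
    using expansion[of "\<mu>\<^sub>0 + z"] z by (simp add: dist_norm)
  then have "(\<lambda>N. onorm (?E N) * norm f) \<longlonglongrightarrow> 0"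
    by (rule tendsto_mult_left_zero)
  then have "(\<lambda>N. ?E N f) \<longlonglongrightarrow> 0"
    by (rule Lim_null_comparison[rotated]) (simp add: onorm[OF bl])
  then have "(\<lambda>N. resolvent D A (\<mu>\<^sub>0 + z) f - ?E N f) \<longlonglongrightarrow> resolvent D A (\<mu>\<^sub>0 + z) f - 0"
    by (intro tendsto_diff tendsto_const)
  then show ?thesis by (simp add: sums_def)
qed

text \<open>This is Abel's lemma: the terms of the convergent series at a point of modulus larger than
  \<open>x\<close> are bounded.\<close>

lemma coeff_summable:
  assumes x: "0 \<le> x" "x < r"
  shows "summable (\<lambda>k. norm (U k f) * x ^ k)"
proof -
  obtain y where y: "x < y" "y < r" using x dense by blast
  then have y0: "y > 0" using x by simp
  have "(\<lambda>k. (of_real y powi (int k - int m)) *\<^sub>C U k f) \<longlonglongrightarrow> 0"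
    using resolvent_sums[of "of_real y" f] y y0 by (intro summable_LIMSEQ_zero) (auto simp: summable_def)
  then have "Bseq (\<lambda>k. (of_real y powi (int k - int m)) *\<^sub>C U k f)"
    using convergent_imp_Bseq convergentI by blast
  then obtain K where K: "\<And>k. norm ((of_real y powi (int k - int m)) *\<^sub>C U k f) \<le> K"
    by (auto simp: Bseq_def)
  have "norm (U k f) * y ^ k \<le> K * y ^ m" for k
  proof -
    have "y powi (int k - int m) * norm (U k f) \<le> K"
      using K[of k] y0 by (simp add: norm_scaleC norm_power_int)
    then have "y powi (int k - int m) * norm (U k f) * y ^ m \<le> K * y ^ m"
      using y0 by (intro mult_right_mono) auto
    then show ?thesis using y0 by (simp add: power_int_diff mult_ac)
  qed
  then show ?thesis by (rule Abel_lemma[OF x(1) y(1)])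
qed

text \<open>The limit is dominated by the real power series with coefficients \<open>norm (U k f)\<close>, which is
  continuous at \<open>0\<close>.\<close>

lemma leading_coeff_limit: "((\<lambda>z. z ^ m *\<^sub>C resolvent D A (\<mu>\<^sub>0 + z) f) \<longlongrightarrow> U 0 f) (at 0)"
proof -
  define a where "a k = norm (U k f)" for k
  define g where "g x = (\<Sum>k. a k * x ^ k)" for x :: real
  have "summable (\<lambda>k. a k * (r / 2) ^ k)"
    unfolding a_def using r_pos by (intro coeff_summable) auto
  then have "isCont g 0"
    unfolding g_def using r_pos by (intro isCont_powser[where K = "r/2"]) auto
  moreover have "g 0 = a 0" by (simp add: g_def)
  ultimately have "((\<lambda>x. g x) \<longlongrightarrow> a 0) (at 0)" by (simp add: isCont_def)
  moreover have "filterlim (\<lambda>z::complex. cmod z) (at 0) (at 0)"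
    unfolding filterlim_at by (auto simp: eventually_at_filter intro!: tendsto_eq_intros)
  ultimately have "((\<lambda>z::complex. g (cmod z) - a 0) \<longlongrightarrow> a 0 - a 0) (at 0)"
    by (intro tendsto_diff tendsto_const) (rule filterlim_compose)
  then have lim: "((\<lambda>z::complex. g (cmod z) - a 0) \<longlongrightarrow> 0) (at 0)" by simp
  have bound: "norm (z ^ m *\<^sub>C resolvent D A (\<mu>\<^sub>0 + z) f - U 0 f) \<le> g (cmod z) - a 0"
    if z: "z \<noteq> 0" "cmod z < r" for z
  proof -
    have "(\<lambda>k. z ^ m *\<^sub>C ((z powi (int k - int m)) *\<^sub>C U k f)) sums
        (z ^ m *\<^sub>C resolvent D A (\<mu>\<^sub>0 + z) f)"
      by (intro bounded_linear.sums[OF bounded_bilinear.bounded_linear_right[OF bounded_bilinear_scaleC]]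
          resolvent_sums z)
    moreover have "z ^ m *\<^sub>C ((z powi (int k - int m)) *\<^sub>C U k f) = z ^ k *\<^sub>C U k f" for k
      using z by (simp add: power_int_diff)
    ultimately have 1: "(\<lambda>k. z ^ k *\<^sub>C U k f) sums (z ^ m *\<^sub>C resolvent D A (\<mu>\<^sub>0 + z) f)"
      by (simp only:)
    have S: "summable (\<lambda>k. a k * cmod z ^ k)"
      unfolding a_def using z by (intro coeff_summable) auto
    have 2: "(\<lambda>k. z ^ Suc k *\<^sub>C U (Suc k) f) sums (z ^ m *\<^sub>C resolvent D A (\<mu>\<^sub>0 + z) f - U 0 f)"
      using 1 by (subst sums_Suc_iff) simp
    have 3: "(\<lambda>k. a (Suc k) * cmod z ^ Suc k) sums (g (cmod z) - a 0)"
      using summable_sums[OF S] by (subst sums_Suc_iff) (simp add: g_def)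
    have eq: "norm (z ^ Suc k *\<^sub>C U (Suc k) f) = a (Suc k) * cmod z ^ Suc k" for k
      by (simp add: norm_scaleC norm_mult norm_power a_def)
    have "summable (\<lambda>k. norm (z ^ Suc k *\<^sub>C U (Suc k) f))"
      using 3 unfolding eq by (rule sums_summable)
    then have "norm (\<Sum>k. z ^ Suc k *\<^sub>C U (Suc k) f) \<le> (\<Sum>k. norm (z ^ Suc k *\<^sub>C U (Suc k) f))"
      by (rule summable_norm)
    then show ?thesis unfolding eq using sums_unique[OF 2] sums_unique[OF 3] by simp
  qed
  have "eventually (\<lambda>z. z \<noteq> 0 \<and> cmod z < r) (at 0)"
    using r_pos by (auto simp: eventually_at intro!: exI[of _ r])
  then have "eventually (\<lambda>z. norm (z ^ m *\<^sub>C resolvent D A (\<mu>\<^sub>0 + z) f - U 0 f)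
      \<le> g (cmod z) - a 0) (at 0)"
    by (rule eventually_mono) (use bound in auto)
  then have "((\<lambda>z. z ^ m *\<^sub>C resolvent D A (\<mu>\<^sub>0 + z) f - U 0 f) \<longlongrightarrow> 0) (at 0)"
    using lim by (rule Lim_null_comparison)
  then show ?thesis by (rule LIM_zero_cancel)
qed

lemma eventually_in_resolvent_set: "\<forall>\<^sub>F z in at 0. z \<noteq> 0 \<and> \<mu>\<^sub>0 + z \<in> resolvent_set D A"
  using r_pos shifted_in_resolvent_set by (auto simp: eventually_at intro!: exI[of _ r])

lemma leading_coeff_commute:
  assumes l: "l \<in> resolvent_set D A"
  shows "U 0 (resolvent D A l f) = resolvent D A l (U 0 f)"
proof -
  note cl = resolvent_bounded_clinear[OF l]
  have "((\<lambda>z. resolvent D A l (z ^ m *\<^sub>C resolvent D A (\<mu>\<^sub>0 + z) f)) \<longlongrightarrow> resolvent D A l (U 0 f)) (at 0)"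
    by (rule bounded_linear.tendsto[OF bounded_clinear_bounded_linear[OF cl] leading_coeff_limit])
  moreover have "\<forall>\<^sub>F z in at 0. resolvent D A l (z ^ m *\<^sub>C resolvent D A (\<mu>\<^sub>0 + z) f)
      = z ^ m *\<^sub>C resolvent D A (\<mu>\<^sub>0 + z) (resolvent D A l f)"
    using eventually_in_resolvent_set
    by (rule eventually_mono) (auto simp: bounded_clinear_scaleC[OF cl] resolvent_commute[OF l])
  ultimately have "((\<lambda>z. z ^ m *\<^sub>C resolvent D A (\<mu>\<^sub>0 + z) (resolvent D A l f)) \<longlongrightarrow>
      resolvent D A l (U 0 f)) (at 0)"
    by (rule Lim_transform_eventually)
  with leading_coeff_limit show ?thesis by (rule tendsto_unique[rotated]) simp
qed

text \<open>Multiply the resolvent identity for \<open>l\<close> and \<open>\<mu>\<^sub>0 + z\<close> by \<open>z ^ m\<close> and let \<open>z\<close> tend to \<open>0\<close>: the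
  summand \<open>z ^ m *\<^sub>C R(l, A) f\<close> disappears because \<open>m > 0\<close>, and what remains says that \<open>U 0 f\<close> is
  an eigenvector for \<open>\<mu>\<^sub>0\<close>.\<close>

lemma resolvent_leading_coeff:
  assumes l: "l \<in> resolvent_set D A" "l \<noteq> \<mu>\<^sub>0" and m: "m > 0"
  shows "resolvent D A l (U 0 f) = (1 / (l - \<mu>\<^sub>0)) *\<^sub>C U 0 f"
proof -
  note cl = resolvent_bounded_clinear[OF l(1)]
  have z0: "((\<lambda>z::complex. z ^ m) \<longlongrightarrow> 0) (at 0)"
    using m by (auto intro!: tendsto_eq_intros simp: zero_power)
  have "((\<lambda>z. z ^ m *\<^sub>C resolvent D A (\<mu>\<^sub>0 + z) f - z ^ m *\<^sub>C resolvent D A l f)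
      \<longlongrightarrow> U 0 f - 0 *\<^sub>C resolvent D A l f) (at 0)"
    by (intro tendsto_diff leading_coeff_limit tendsto_scaleC z0 tendsto_const)
  moreover have "\<forall>\<^sub>F z in at 0. z ^ m *\<^sub>C resolvent D A (\<mu>\<^sub>0 + z) f - z ^ m *\<^sub>C resolvent D A l f
      = (l - (\<mu>\<^sub>0 + z)) *\<^sub>C resolvent D A l (z ^ m *\<^sub>C resolvent D A (\<mu>\<^sub>0 + z) f)"
    using eventually_in_resolvent_set
  proof (rule eventually_mono)
    fix z assume z: "z \<noteq> 0 \<and> \<mu>\<^sub>0 + z \<in> resolvent_set D A"
    have "z ^ m *\<^sub>C resolvent D A (\<mu>\<^sub>0 + z) f - z ^ m *\<^sub>C resolvent D A l f
        = z ^ m *\<^sub>C (resolvent D A (\<mu>\<^sub>0 + z) f - resolvent D A l f)"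
      by (simp add: cplx.scale_right_diff_distrib)
    also have "\<dots> = z ^ m *\<^sub>C ((l - (\<mu>\<^sub>0 + z)) *\<^sub>C resolvent D A l (resolvent D A (\<mu>\<^sub>0 + z) f))"
      using z by (simp only: resolvent_identity[OF l(1)])
    finally show "z ^ m *\<^sub>C resolvent D A (\<mu>\<^sub>0 + z) f - z ^ m *\<^sub>C resolvent D A l f
      = (l - (\<mu>\<^sub>0 + z)) *\<^sub>C resolvent D A l (z ^ m *\<^sub>C resolvent D A (\<mu>\<^sub>0 + z) f)"
      by (simp add: bounded_clinear_scaleC[OF cl] mult.commute)
  qed
  ultimately have "((\<lambda>z. (l - (\<mu>\<^sub>0 + z)) *\<^sub>C resolvent D A l (z ^ m *\<^sub>C resolvent D A (\<mu>\<^sub>0 + z) f))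
      \<longlongrightarrow> U 0 f - 0 *\<^sub>C resolvent D A l f) (at 0)"
    by (rule Lim_transform_eventually)
  moreover have "((\<lambda>z. (l - (\<mu>\<^sub>0 + z)) *\<^sub>C resolvent D A l (z ^ m *\<^sub>C resolvent D A (\<mu>\<^sub>0 + z) f))
      \<longlongrightarrow> (l - (\<mu>\<^sub>0 + 0)) *\<^sub>C resolvent D A l (U 0 f)) (at 0)"
    by (intro tendsto_scaleC tendsto_intros leading_coeff_limit
        bounded_linear.tendsto[OF bounded_clinear_bounded_linear[OF cl]])
  ultimately have "U 0 f - 0 *\<^sub>C resolvent D A l f = (l - (\<mu>\<^sub>0 + 0)) *\<^sub>C resolvent D A l (U 0 f)"
    by (rule tendsto_unique[rotated]) simp
  then have "(l - \<mu>\<^sub>0) *\<^sub>C resolvent D A l (U 0 f) = U 0 f" by simp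
  then show ?thesis using l(2)
    by (metis cplx.scale_scale cplx.scale_one nonzero_eq_divide_eq right_minus_eq)
qed

text \<open>On the eigenvector \<open>U 0 f\<close> the resolvent has only a simple pole, which \<open>z ^ m\<close> more than
  compensates.\<close>

lemma leading_coeff_square:
  assumes m: "m > 1" shows "U 0 (U 0 f) = 0"
proof -
  have "((\<lambda>z::complex. z ^ (m - 1) *\<^sub>C U 0 f) \<longlongrightarrow> 0 *\<^sub>C U 0 f) (at 0)"
    using m by (intro tendsto_scaleC tendsto_const) (auto intro!: tendsto_eq_intros simp: zero_power)
  moreover have "\<forall>\<^sub>F z in at 0. z ^ (m - 1) *\<^sub>C U 0 f = z ^ m *\<^sub>C resolvent D A (\<mu>\<^sub>0 + z) (U 0 f)"
    using eventually_in_resolvent_set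
  proof (rule eventually_mono)
    fix z assume z: "z \<noteq> 0 \<and> \<mu>\<^sub>0 + z \<in> resolvent_set D A"
    then have "resolvent D A (\<mu>\<^sub>0 + z) (U 0 f) = (1 / z) *\<^sub>C U 0 f"
      using resolvent_leading_coeff[of "\<mu>\<^sub>0 + z" f] m by simp
    moreover have "z ^ m * (1 / z) = z ^ (m - 1)"
      using m z by (cases m) auto
    ultimately show "z ^ (m - 1) *\<^sub>C U 0 f = z ^ m *\<^sub>C resolvent D A (\<mu>\<^sub>0 + z) (U 0 f)"
      by (metis cplx.scale_scale)
  qed
  ultimately have "((\<lambda>z. z ^ m *\<^sub>C resolvent D A (\<mu>\<^sub>0 + z) (U 0 f)) \<longlongrightarrow> 0 *\<^sub>C U 0 f) (at 0)"
    by (rule Lim_transform_eventually)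
  then have "((\<lambda>z. z ^ m *\<^sub>C resolvent D A (\<mu>\<^sub>0 + z) (U 0 f)) \<longlongrightarrow> 0) (at 0)"
    by simp
  with leading_coeff_limit show ?thesis by (rule tendsto_unique[rotated]) simp
qed

end


lemma resolvent_pole_laurent:
  assumes "resolvent_pole D A \<mu>\<^sub>0"
  shows "\<exists>m r U. resolvent_laurent D A \<mu>\<^sub>0 m r U \<and> m > 0 \<and> U 0 \<noteq> (\<lambda>f. 0)"
  using assms unfolding resolvent_pole_def resolvent_laurent_def
  by (elim ex_forward) simp


section \<open>The spectral projection is the residue\<close>

lemma has_integral_circle_power:
  fixes j :: int
  assumes \<rho>: "\<rho> > 0"
  shows "((\<lambda>t. \<i> * (of_real \<rho> * cis t) powi j) has_integral (if j = 0 then 2 * pi * \<i> else 0))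
    {0..2 * pi}"
proof (cases "j = 0")
  case True
  then show ?thesis
    using has_integral_const_real[of \<i> 0 "2 * pi"] by (simp add: scaleR_conv_of_real)
next
  case False
  have eq: "(of_real \<rho> * cis t) powi j = of_real (\<rho> powi j) * exp (\<i> * of_int j * of_real t)" for t
    by (simp add: power_int_mult_distrib cis_conv_exp exp_power_int mult_ac)
  have "((\<lambda>t. \<i> * (of_real \<rho> * cis t) powi j) has_integral
      (of_real \<rho> * cis (2 * pi)) powi j / of_int j - (of_real \<rho> * cis 0) powi j / of_int j) {0..2 * pi}"
    unfolding eq
  proof (rule fundamental_theorem_of_calculus)
    fix t :: real
    show "((\<lambda>t. of_real (\<rho> powi j) * exp (\<i> * of_int j * of_real t) / of_int j) has_vector_derivative
        \<i> * (of_real (\<rho> powi j) * exp (\<i> * of_int j * of_real t))) (at t within {0..2 * pi})"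
      using False by (auto intro!: derivative_eq_intros has_vector_derivative_real_field)
  qed simp
  then show ?thesis using False by (simp add: cis_2pi)
qed

context resolvent_laurent
begin

text \<open>The Laurent series converges uniformly on the circle and may be integrated term by term; only
  the term with the power \<open>- 1\<close> contributes. The factor \<open>w = \<rho> cis t\<close> from \<open>d\<mu> = \<i> w dt\<close> is
  absorbed into the powers, so that term \<open>k\<close> has the exponent \<open>k - (m - 1)\<close>.\<close>

lemma circle_integral_resolvent:
  assumes m: "m > 0" and \<rho>: "\<rho> > 0" "\<rho> < r"
  shows "circle_integral \<mu>\<^sub>0 \<rho> (\<lambda>\<mu>. resolvent D A \<mu> f) = (2 * pi * \<i>) *\<^sub>C U (m - 1) f"
proof -
  define w where "w t = of_real \<rho> * cis t" for t
  define F where "F k t = (\<i> * w t powi (int k - int (m - 1))) *\<^sub>C U k f" for k t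
  have w: "w t \<noteq> 0" "cmod (w t) = \<rho>" for t using \<rho> by (auto simp: w_def norm_mult)
  have F_sums: "(\<lambda>k. F k t) sums ((\<i> * w t) *\<^sub>C resolvent D A (\<mu>\<^sub>0 + w t) f)" for t
  proof -
    have "(\<lambda>k. (\<i> * w t) *\<^sub>C ((w t powi (int k - int m)) *\<^sub>C U k f)) sums
        ((\<i> * w t) *\<^sub>C resolvent D A (\<mu>\<^sub>0 + w t) f)"
      using w[of t] \<rho>
      by (intro bounded_linear.sums[OF bounded_bilinear.bounded_linear_right[OF bounded_bilinear_scaleC]]
          resolvent_sums) auto
    moreover have "w t * w t powi (int k - int m) = w t powi (int k - int (m - 1))" for k
    proof -
      have "int k - int (m - 1) = 1 + (int k - int m)" using m by (simp add: of_nat_diff)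
      moreover have "w t powi (1 + (int k - int m)) = w t powi 1 * w t powi (int k - int m)"
        using w(1)[of t] by (intro power_int_add) simp
      ultimately show ?thesis by (simp only: power_int_1_right)
    qed
    ultimately show ?thesis by (simp add: F_def mult.assoc)
  qed
  have norm_F: "norm (F k t) \<le> \<rho> powi (- int (m - 1)) * (norm (U k f) * \<rho> ^ k)" for k t
    using \<rho> w by (simp add: F_def norm_scaleC norm_mult norm_power_int norm_power norm_inverse power_int_diff
        power_int_minus divide_inverse)
  have F_int: "(F k has_integral (if k = m - 1 then (2 * pi * \<i>) *\<^sub>C U k f else 0)) {0..2 * pi}" for k
  proof -
    have "((\<lambda>t. (\<i> * w t powi (int k - int (m - 1))) *\<^sub>C U k f) has_integral
        (if int k - int (m - 1) = 0 then 2 * pi * \<i> else 0) *\<^sub>C U k f) {0..2 * pi}"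
      using has_integral_linear[OF has_integral_circle_power[OF \<rho>(1)]
          bounded_bilinear.bounded_linear_left[OF bounded_bilinear_scaleC, of "U k f"]]
      unfolding w_def o_def .
    then show ?thesis unfolding F_def by (auto split: if_splits)
  qed
  have cont: "continuous_on (cbox 0 (2 * pi)) (\<lambda>t. \<Sum>k<N. F k t)" for N
    unfolding F_def w_def using \<rho>
    by (intro continuous_on_sum bounded_bilinear.continuous_on[OF bounded_bilinear_scaleC]
        continuous_intros) auto
  have "uniform_limit (cbox 0 (2 * pi)) (\<lambda>N t. \<Sum>k<N. F k t) (\<lambda>t. \<Sum>k. F k t) sequentially"
    by (rule Weierstrass_m_test[OF norm_F]) (use \<rho> in \<open>intro summable_mult coeff_summable; simp\<close>)
  then obtain I J where I: "\<And>N. ((\<lambda>t. \<Sum>k<N. F k t) has_integral I N) (cbox 0 (2 * pi))"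
    and J: "((\<lambda>t. \<Sum>k. F k t) has_integral J) (cbox 0 (2 * pi))" and IJ: "I \<longlonglongrightarrow> J"
    by (rule uniform_limit_integral_cbox[OF _ cont]) auto
  have "I N = (\<Sum>k<N. if k = m - 1 then (2 * pi * \<i>) *\<^sub>C U k f else 0)" for N
    by (rule has_integral_unique[OF I]) (simp only: box_real, intro has_integral_sum F_int finite_lessThan)
  then have "I N = (2 * pi * \<i>) *\<^sub>C U (m - 1) f" if "N \<ge> m" for N
    using that m by (simp add: less_eq_Suc_le)
  then have "I \<longlonglongrightarrow> (2 * pi * \<i>) *\<^sub>C U (m - 1) f"
    by (intro tendsto_eventually) (auto simp: eventually_sequentially)
  then have "J = (2 * pi * \<i>) *\<^sub>C U (m - 1) f" using IJ LIMSEQ_unique by blast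
  then have "integral {0..2 * pi} (\<lambda>t. \<Sum>k. F k t) = (2 * pi * \<i>) *\<^sub>C U (m - 1) f"
    using J by (simp add: integral_unique)
  then show ?thesis
    unfolding circle_integral_def sums_unique[OF F_sums, symmetric] by (simp add: w_def mult.assoc)
qed

lemma spectral_projection_eq_residue:
  assumes m: "m > 0" shows "spectral_projection D A \<mu>\<^sub>0 = U (m - 1)"
proof
  fix f
  have ev: "\<forall>\<^sub>F \<rho> in at_right 0. (1 / (2 * pi * \<i>)) *\<^sub>C circle_integral \<mu>\<^sub>0 \<rho> (\<lambda>\<mu>. resolvent D A \<mu> f)
      = U (m - 1) f"
    unfolding eventually_at_right_field
    using r_pos circle_integral_resolvent[OF m] by (auto intro!: exI[of _ r])
  show "spectral_projection D A \<mu>\<^sub>0 f = U (m - 1) f"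
    unfolding spectral_projection_def
  proof (rule the_equality)
    show "\<forall>\<^sub>F \<rho> in at_right 0. U (m - 1) f =
        (1 / (2 * pi * \<i>)) *\<^sub>C circle_integral \<mu>\<^sub>0 \<rho> (\<lambda>\<mu>. resolvent D A \<mu> f)"
      using ev by (rule eventually_mono) simp
    fix y assume "\<forall>\<^sub>F \<rho> in at_right 0. y =
        (1 / (2 * pi * \<i>)) *\<^sub>C circle_integral \<mu>\<^sub>0 \<rho> (\<lambda>\<mu>. resolvent D A \<mu> f)"
    with ev have "\<forall>\<^sub>F \<rho> in at_right (0::real). y = U (m - 1) f" by eventually_elim simp
    then show "y = U (m - 1) f" by simp
  qed
qed

end


section \<open>Positivity of the leading coefficient\<close>

text \<open>A positive operator that kills \<open>u\<close> kills every real \<open>x\<close> with \<open>- c u \<le> x \<le> c u\<close>, hence the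
  principal ideal.\<close>

lemma positive_operator_eq_zero:
  fixes V :: "'a::banach_lattice complexification \<Rightarrow> 'a complexification"
  assumes V: "bounded_clinear V" and pos: "\<And>f. 0 \<le> f \<Longrightarrow> 0 \<le> V f"
    and u: "quasi_interior_point u" and Vu: "V u = 0"
  shows "V f = 0"
proof -
  note lin = bounded_linear.linear[OF bounded_clinear_bounded_linear[OF V]]
  have real: "V (Cplx x 0) = 0" if x: "\<bar>x\<bar> \<le> c *\<^sub>R re u" and u0: "im u = 0" for x c
  proof -
    have "x \<le> c *\<^sub>R re u" "- x \<le> c *\<^sub>R re u" using x by (auto simp: abs_le_iff)
    then have "0 \<le> c *\<^sub>R u - Cplx x 0" "0 \<le> c *\<^sub>R u + Cplx x 0"
      using u0 by (auto simp: less_eq_complexification_def) (metis add.commute neg_le_iff_le minus_le_iff diff_ge_0_iff_ge diff_minus_eq_add)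
    from pos[OF this(1)] pos[OF this(2)] have "0 \<le> - V (Cplx x 0)" "0 \<le> V (Cplx x 0)"
      by (simp_all add: linear_diff[OF lin] linear_add[OF lin] linear_scale[OF lin] Vu)
    then show ?thesis by (simp add: antisym)
  qed
  have zero: "V g = 0" if g: "g \<in> principal_ideal u" for g
  proof -
    obtain c where c: "modulus g \<le> c *\<^sub>R re u" and u0: "im u = 0"
      using g u
      by (auto simp: principal_ideal_def quasi_interior_point_def abs_complexification_def
          less_eq_complexification_def)
    have "V (Cplx (re g) 0) = 0" "V (Cplx (im g) 0) = 0"
      using order_trans[OF abs_re_le_modulus c] order_trans[OF abs_im_le_modulus c] u0
      by (auto intro: real)
    then have "V (Cplx (re g) 0 + \<i> *\<^sub>C Cplx (im g) 0) = 0"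
      by (simp add: linear_add[OF lin] bounded_clinear_scaleC[OF V])
    then show ?thesis by (simp flip: cplx_decomp)
  qed
  have cont: "continuous_on (closure (principal_ideal u)) V"
    by (rule bounded_linear.continuous_on[OF bounded_clinear_bounded_linear[OF V] continuous_on_id])
  show ?thesis
  proof (rule continuous_constant_on_closure[OF cont])
    show "f \<in> closure (principal_ideal u)" using u by (simp add: quasi_interior_point_def)
  qed (rule zero)
qed

lemma strongly_positive_vec_scaleR:
  assumes "strongly_positive_vec u f" "a > 0" shows "strongly_positive_vec u (a *\<^sub>R f)"
proof -
  obtain e where "e > 0" "e *\<^sub>R u \<le> f" and f: "0 \<le> f"
    using assms by (auto simp: strongly_positive_vec_def)
  then have "a * e > 0" "(a * e) *\<^sub>R u \<le> a *\<^sub>R f"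
    using assms(2) scaleR_left_mono[of "e *\<^sub>R u" f a] by auto
  then show ?thesis using f assms(2) unfolding strongly_positive_vec_def
    by (meson less_imp_le scaleR_nonneg_nonneg)
qed

text \<open>Both kinds of eventual sign at once: \<open>s\<close> is the sign of the resolvent and also tells from
  which side the real axis approaches the pole.\<close>

locale signed_resolvent_laurent = resolvent_laurent D A \<mu>\<^sub>0 m r U
  for D :: "'a::banach_lattice complexification set"
    and A :: "'a complexification \<Rightarrow> 'a complexification"
    and \<mu>\<^sub>0 :: complex and m :: nat and r :: real
    and U :: "nat \<Rightarrow> 'a complexification \<Rightarrow> 'a complexification" +
  fixes u :: "'a complexification" and s :: real
  assumes m_pos: "m > 0" and leading_nonzero: "U 0 \<noteq> (\<lambda>f. 0)"
    and quasi_interior: "quasi_interior_point u"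
    and sign: "s = 1 \<or> s = - 1"
    and ev_positive: "0 < f \<Longrightarrow> \<exists>\<delta>\<^sub>1>0. \<forall>\<delta>\<in>{0<..\<delta>\<^sub>1}. \<mu>\<^sub>0 + of_real (s * \<delta>) \<in> resolvent_set D A \<and>
      strongly_positive_vec u (s *\<^sub>R resolvent D A (\<mu>\<^sub>0 + of_real (s * \<delta>)) f)"
begin

text \<open>At distance \<open>\<delta>\<close> from the pole, on the side given by \<open>s\<close>, the vectors that tend to \<open>U 0 f\<close> are
  \<open>(s \<delta>) ^ m R f = s ^ (m + 1) \<delta> ^ m (s R f)\<close>, where \<open>s R f\<close> is positive. This determines the
  sign that turns the leading coefficient into a positive operator.\<close>

definition V :: "'a complexification \<Rightarrow> 'a complexification" where
  "V f = s ^ (m + 1) *\<^sub>R U 0 f"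

lemma sign_square: "s * s = 1"
  using sign by auto

lemma V_nonneg:
  assumes f: "0 \<le> f" shows "0 \<le> V f"
proof (cases "f = 0")
  case True
  then show ?thesis
    using linear_0[OF bounded_linear.linear[OF bounded_clinear_bounded_linear[OF coeff]]]
    by (simp add: V_def)
next
  case False
  then have "0 < f" using f by (simp add: less_complexification_def)
  then obtain \<delta>\<^sub>1 where \<delta>\<^sub>1: "\<delta>\<^sub>1 > 0"
    and sp: "\<And>\<delta>. \<delta> \<in> {0<..\<delta>\<^sub>1} \<Longrightarrow> strongly_positive_vec u (s *\<^sub>R resolvent D A (\<mu>\<^sub>0 + of_real (s * \<delta>)) f)"
    using ev_positive by blast
  let ?z = "\<lambda>\<delta>. complex_of_real (s * \<delta>)"
  have "filterlim ?z (at 0) (at_right 0)"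
    unfolding filterlim_at using sign
    by (auto simp: eventually_at_filter intro!: tendsto_eq_intros)
  then have lim: "((\<lambda>\<delta>. s ^ (m + 1) *\<^sub>R (?z \<delta> ^ m *\<^sub>C resolvent D A (\<mu>\<^sub>0 + ?z \<delta>) f)) \<longlongrightarrow> V f) (at_right 0)"
    unfolding V_def
    by (intro tendsto_scaleR tendsto_const filterlim_compose[OF leading_coeff_limit])
  have nonneg: "0 \<le> s ^ (m + 1) *\<^sub>R (?z \<delta> ^ m *\<^sub>C resolvent D A (\<mu>\<^sub>0 + ?z \<delta>) f)" if "\<delta> \<in> {0<..\<delta>\<^sub>1}" for \<delta>
  proof -
    have "?z \<delta> ^ m = complex_of_real ((s * \<delta>) ^ m)" by simp
    then have "s ^ (m + 1) *\<^sub>R (?z \<delta> ^ m *\<^sub>C resolvent D A (\<mu>\<^sub>0 + ?z \<delta>) f)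
        = (s ^ (m + 1) * (s * \<delta>) ^ m) *\<^sub>R resolvent D A (\<mu>\<^sub>0 + ?z \<delta>) f"
      by (simp only: scaleC_of_real scaleR_scaleR)
    also have "s ^ (m + 1) * (s * \<delta>) ^ m = (s * s) ^ m * (\<delta> ^ m * s)"
      by (simp add: power_mult_distrib)
    finally show ?thesis
      using sp[OF that] that
      by (simp add: sign_square strongly_positive_vec_def scaleR_nonneg_nonneg flip: scaleR_scaleR)
  qed
  have "\<forall>\<^sub>F \<delta> in at_right 0. \<delta> \<in> {0<..\<delta>\<^sub>1}"
    using \<delta>\<^sub>1 by (auto simp: eventually_at_right_field intro!: exI[of _ \<delta>\<^sub>1])
  then have "\<forall>\<^sub>F \<delta> in at_right 0.
      s ^ (m + 1) *\<^sub>R (?z \<delta> ^ m *\<^sub>C resolvent D A (\<mu>\<^sub>0 + ?z \<delta>) f) \<in> {z. 0 \<le> z}"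
    by (rule eventually_mono) (use nonneg in blast)
  then have "V f \<in> {z. 0 \<le> z}"
    using Lim_in_closed_set[OF closed_nonneg_complexification _ _ lim] by simp
  then show ?thesis by simp
qed

lemma V_bounded_clinear: "bounded_clinear V"
proof -
  note U = coeff[of 0]
  have add: "V (f + g) = V f + V g" for f g
    by (simp only: V_def linear_add[OF bounded_linear.linear[OF bounded_clinear_bounded_linear[OF U]]]
        scaleR_add_right)
  have scale: "V (c *\<^sub>C f) = c *\<^sub>C V f" for c f
    by (simp only: V_def bounded_clinear_scaleC[OF U] bounded_bilinear.scaleR_right[OF bounded_bilinear_scaleC])
  have "Vector_Spaces.linear scaleC scaleC V"
    unfolding Vector_Spaces.linear_iff using cplx.vector_space_axioms add scale by blast
  moreover have "bounded_linear V"
    unfolding V_def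
    by (intro bounded_linear_compose[OF bounded_linear_scaleR_right] bounded_clinear_bounded_linear U)
  ultimately show ?thesis by (simp add: bounded_clinear_def)
qed

text \<open>If \<open>V f = 0\<close>, then \<open>V\<close> kills \<open>s R f\<close>, because the leading coefficient commutes with the
  resolvent; since \<open>s R f\<close> dominates a multiple of \<open>u\<close>, positivity forces \<open>V u = 0\<close>, and then
  \<open>V = 0\<close> because \<open>u\<close> is quasi-interior.\<close>

lemma V_pos:
  assumes f: "0 < f" shows "0 < V f"
proof (rule ccontr)
  note lin = bounded_linear.linear[OF bounded_clinear_bounded_linear[OF V_bounded_clinear]]
  assume "\<not> 0 < V f"
  then have "V f = 0" using V_nonneg[of f] f by (auto simp: less_complexification_def)
  then have Uf: "U 0 f = 0" using sign by (auto simp: V_def)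
  obtain \<delta> where l: "\<mu>\<^sub>0 + of_real (s * \<delta>) \<in> resolvent_set D A"
    and sp: "strongly_positive_vec u (s *\<^sub>R resolvent D A (\<mu>\<^sub>0 + of_real (s * \<delta>)) f)"
    using ev_positive[OF f] by (metis greaterThanAtMost_iff order_refl)
  let ?R = "resolvent D A (\<mu>\<^sub>0 + of_real (s * \<delta>))"
  have "?R 0 = 0"
    using linear_0 bounded_linear.linear bounded_clinear_bounded_linear resolvent_bounded_clinear[OF l]
    by blast
  then have VR: "V (s *\<^sub>R ?R f) = 0"
    unfolding linear_scale[OF lin]
    by (simp only: V_def leading_coeff_commute[OF l] Uf scaleR_zero_right)
  obtain e where e: "e > 0" "e *\<^sub>R u \<le> s *\<^sub>R ?R f" using sp by (auto simp: strongly_positive_vec_def)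
  then have "0 \<le> V (s *\<^sub>R ?R f - e *\<^sub>R u)" by (intro V_nonneg) simp
  then have "e *\<^sub>R V u \<le> 0" by (simp only: linear_diff[OF lin] linear_scale[OF lin, of e] VR) simp
  then have "inverse e *\<^sub>R (e *\<^sub>R V u) \<le> inverse e *\<^sub>R 0" using e by (intro scaleR_left_mono) auto
  then have "V u \<le> 0" using e by simp
  moreover have "0 \<le> V u"
    using quasi_interior by (intro V_nonneg) (simp add: quasi_interior_point_def)
  ultimately have Vu: "V u = 0" by (rule antisym)
  have "V g = 0" for g
  proof (rule positive_operator_eq_zero[where V = V and u = u])
    show "0 \<le> V h" if "0 \<le> h" for h using that by (rule V_nonneg)
  qed (rule V_bounded_clinear quasi_interior Vu)+
  then have "U 0 = (\<lambda>f. 0)" using sign by (auto simp: V_def)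
  with leading_nonzero show False by simp
qed

text \<open>A pole of higher order has \<open>V \<circ> V = 0\<close>, while \<open>V\<close> maps positive nonzero vectors to positive
  nonzero vectors.\<close>

lemma pole_simple:
  assumes "0 < (f :: 'a complexification)" shows "m = 1"
proof (rule ccontr)
  assume "m \<noteq> 1"
  with m_pos have "m > 1" by simp
  then have "V (V f) = 0"
    unfolding V_def linear_scale[OF bounded_linear.linear[OF bounded_clinear_bounded_linear[OF coeff[of 0]]]]
    by (simp only: leading_coeff_square scaleR_zero_right)
  moreover have "0 < V (V f)" using assms by (intro V_pos)
  ultimately show False by simp
qed

text \<open>\<open>V f\<close> is itself a positive vector, so its resolvent dominates a multiple of \<open>u\<close> up to the sign
  \<open>s\<close>; but \<open>V f\<close> is an eigenvector, so \<open>s\<close> times its resolvent is just \<open>V f / \<delta>\<close>.\<close>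

lemma V_strongly_positive:
  assumes f: "0 < f" shows "strongly_positive_vec u (V f)"
proof -
  obtain \<delta> where \<delta>: "\<delta> > 0" and l: "\<mu>\<^sub>0 + of_real (s * \<delta>) \<in> resolvent_set D A"
    and sp: "strongly_positive_vec u (s *\<^sub>R resolvent D A (\<mu>\<^sub>0 + of_real (s * \<delta>)) (V f))"
    using ev_positive[OF V_pos[OF f]] by (metis greaterThanAtMost_iff order_refl)
  note lin = bounded_linear.linear[OF bounded_clinear_bounded_linear[OF resolvent_bounded_clinear[OF l]]]
  have ne: "s * \<delta> \<noteq> 0" using \<delta> sign by auto
  have "resolvent D A (\<mu>\<^sub>0 + of_real (s * \<delta>)) (U 0 f) = (1 / complex_of_real (s * \<delta>)) *\<^sub>C U 0 f"
    using resolvent_leading_coeff[OF l, of f] ne m_pos by simp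
  also have "\<dots> = (1 / (s * \<delta>)) *\<^sub>R U 0 f"
    by (metis of_real_1 of_real_divide scaleC_of_real)
  finally have "s *\<^sub>R resolvent D A (\<mu>\<^sub>0 + of_real (s * \<delta>)) (V f)
      = (s * (s ^ (m + 1) * (1 / (s * \<delta>)))) *\<^sub>R U 0 f"
    by (simp only: V_def linear_scale[OF lin, of "s ^ (m + 1)"] scaleR_scaleR)
  also have "s * (s ^ (m + 1) * (1 / (s * \<delta>))) = 1 / \<delta> * s ^ (m + 1)"
    using ne by simp
  finally have "s *\<^sub>R resolvent D A (\<mu>\<^sub>0 + of_real (s * \<delta>)) (V f) = (1 / \<delta>) *\<^sub>R V f"
    by (simp add: V_def)
  then show ?thesis
    using strongly_positive_vec_scaleR[OF sp \<delta>] \<delta> by simp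
qed

theorem spectral_projection_strongly_positive: "strongly_positive_op u (spectral_projection D A \<mu>\<^sub>0)"
proof -
  \<comment> \<open>The simplicity of the pole is drawn from the existence of some \<open>f > 0\<close>, hence the condition.\<close>
  have eq: "spectral_projection D A \<mu>\<^sub>0 = V" if "0 < (f :: 'a complexification)" for f
  proof
    fix g
    have "s ^ (m + 1) = 1" "m - 1 = 0" using pole_simple[OF that] sign_square by simp_all
    then show "spectral_projection D A \<mu>\<^sub>0 g = V g"
      unfolding V_def spectral_projection_eq_residue[OF m_pos] by (simp only: scaleR_one)
  qed
  have "strongly_positive_vec u (spectral_projection D A \<mu>\<^sub>0 f)" if "0 < f" for f
    using V_strongly_positive[OF that] eq[OF that] by simp
  then show ?thesis
    using coeff spectral_projection_eq_residue[OF m_pos] by (simp add: strongly_positive_op_def)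
qed

end


section \<open>Eventual strong positivity or negativity of the resolvent\<close>

text \<open>In terms of the distance \<open>\<delta>\<close> to the pole, both conditions take the form that the locale
  \<open>signed_resolvent_laurent\<close> demands.\<close>

lemma resolvent_ev_strongly_positive_shift:
  assumes "resolvent_ev_strongly_positive D A u \<mu>\<^sub>0" and "0 < f"
  shows "\<exists>\<delta>\<^sub>1>0. \<forall>\<delta>\<in>{0<..\<delta>\<^sub>1}.
    complex_of_real \<mu>\<^sub>0 + of_real (1 * \<delta>) \<in> resolvent_set D A \<and>
    strongly_positive_vec u (1 *\<^sub>R resolvent D A (complex_of_real \<mu>\<^sub>0 + of_real (1 * \<delta>)) f)"
proof -
  obtain \<mu>\<^sub>1 where \<mu>\<^sub>1: "\<mu>\<^sub>1 > \<mu>\<^sub>0"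
    and sub: "complex_of_real ` {\<mu>\<^sub>0<..\<mu>\<^sub>1} \<subseteq> resolvent_set D A"
    and sp: "\<forall>\<mu>\<in>{\<mu>\<^sub>0<..\<mu>\<^sub>1}. strongly_positive_vec u (resolvent D A (complex_of_real \<mu>) f)"
    using assms unfolding resolvent_ev_strongly_positive_def by blast
  show ?thesis
  proof (intro exI conjI ballI)
    show "\<mu>\<^sub>1 - \<mu>\<^sub>0 > 0" using \<mu>\<^sub>1 by simp
    fix \<delta> assume "\<delta> \<in> {0<..\<mu>\<^sub>1 - \<mu>\<^sub>0}"
    then have \<delta>: "\<mu>\<^sub>0 + \<delta> \<in> {\<mu>\<^sub>0<..\<mu>\<^sub>1}" by auto
    have eq: "complex_of_real \<mu>\<^sub>0 + of_real (1 * \<delta>) = of_real (\<mu>\<^sub>0 + \<delta>)" by simp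
    show "complex_of_real \<mu>\<^sub>0 + of_real (1 * \<delta>) \<in> resolvent_set D A"
      unfolding eq by (rule subsetD[OF sub imageI[OF \<delta>]])
    show "strongly_positive_vec u (1 *\<^sub>R resolvent D A (complex_of_real \<mu>\<^sub>0 + of_real (1 * \<delta>)) f)"
      unfolding eq scaleR_one by (rule bspec[OF sp \<delta>])
  qed
qed

lemma resolvent_ev_strongly_negative_shift:
  assumes "resolvent_ev_strongly_negative D A u \<mu>\<^sub>0" and "0 < f"
  shows "\<exists>\<delta>\<^sub>1>0. \<forall>\<delta>\<in>{0<..\<delta>\<^sub>1}.
    complex_of_real \<mu>\<^sub>0 + of_real (- 1 * \<delta>) \<in> resolvent_set D A \<and>
    strongly_positive_vec u (- 1 *\<^sub>R resolvent D A (complex_of_real \<mu>\<^sub>0 + of_real (- 1 * \<delta>)) f)"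
proof -
  obtain \<mu>\<^sub>1 where \<mu>\<^sub>1: "\<mu>\<^sub>1 < \<mu>\<^sub>0"
    and sub: "complex_of_real ` {\<mu>\<^sub>1..<\<mu>\<^sub>0} \<subseteq> resolvent_set D A"
    and sp: "\<forall>\<mu>\<in>{\<mu>\<^sub>1..<\<mu>\<^sub>0}. strongly_positive_vec u (- resolvent D A (complex_of_real \<mu>) f)"
    using assms unfolding resolvent_ev_strongly_negative_def by blast
  show ?thesis
  proof (intro exI conjI ballI)
    show "\<mu>\<^sub>0 - \<mu>\<^sub>1 > 0" using \<mu>\<^sub>1 by simp
    fix \<delta> assume "\<delta> \<in> {0<..\<mu>\<^sub>0 - \<mu>\<^sub>1}"
    then have \<delta>: "\<mu>\<^sub>0 - \<delta> \<in> {\<mu>\<^sub>1..<\<mu>\<^sub>0}" by auto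
    have eq: "complex_of_real \<mu>\<^sub>0 + of_real (- 1 * \<delta>) = of_real (\<mu>\<^sub>0 - \<delta>)" by simp
    show "complex_of_real \<mu>\<^sub>0 + of_real (- 1 * \<delta>) \<in> resolvent_set D A"
      unfolding eq by (rule subsetD[OF sub imageI[OF \<delta>]])
    show "strongly_positive_vec u (- 1 *\<^sub>R resolvent D A (complex_of_real \<mu>\<^sub>0 + of_real (- 1 * \<delta>)) f)"
      unfolding eq scaleR_minus1_left by (rule bspec[OF sp \<delta>])
  qed
qed

theorem theorem4p1:
  fixes A :: "'a::banach_lattice complexification \<Rightarrow> 'a complexification"
    and D :: "'a complexification set"
    and u :: "'a complexification"
    and \<mu>\<^sub>0 :: real
  assumes "linear_operator D A"
    and "closure D = UNIV"
    and "real_operator D A"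
    and "quasi_interior_point u"
    and "complex_of_real \<mu>\<^sub>0 \<in> spectrum D A"
    and "resolvent_pole D A (complex_of_real \<mu>\<^sub>0)"
    and "resolvent_ev_strongly_positive D A u \<mu>\<^sub>0 \<or> resolvent_ev_strongly_negative D A u \<mu>\<^sub>0"
  shows "strongly_positive_op u (spectral_projection D A (complex_of_real \<mu>\<^sub>0))"
proof -
  obtain m r U
    where laurent: "resolvent_laurent D A (complex_of_real \<mu>\<^sub>0) m r U \<and> m > 0 \<and> U 0 \<noteq> (\<lambda>f. 0)"
    using resolvent_pole_laurent[OF assms(6)] by (elim exE)
  note m = laurent[THEN conjunct2, THEN conjunct1] and U = laurent[THEN conjunct2, THEN conjunct2]
  interpret resolvent_laurent D A "complex_of_real \<mu>\<^sub>0" m r U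
    using laurent by (rule conjunct1)
  from assms(7) show ?thesis
  proof (rule disjE)
    assume ev: "resolvent_ev_strongly_positive D A u \<mu>\<^sub>0"
    interpret signed_resolvent_laurent D A "complex_of_real \<mu>\<^sub>0" m r U u 1
    proof unfold_locales
      show "(1::real) = 1 \<or> (1::real) = - 1" by simp
      show "\<exists>\<delta>\<^sub>1>0. \<forall>\<delta>\<in>{0<..\<delta>\<^sub>1}. complex_of_real \<mu>\<^sub>0 + of_real (1 * \<delta>) \<in> resolvent_set D A \<and>
          strongly_positive_vec u (1 *\<^sub>R resolvent D A (complex_of_real \<mu>\<^sub>0 + of_real (1 * \<delta>)) f)"
        if "0 < f" for f
        using ev that by (rule resolvent_ev_strongly_positive_shift)
    qed (rule m U assms(4))+
    show ?thesis by (rule spectral_projection_strongly_positive)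
  next
    assume ev: "resolvent_ev_strongly_negative D A u \<mu>\<^sub>0"
    interpret signed_resolvent_laurent D A "complex_of_real \<mu>\<^sub>0" m r U u "- 1"
    proof unfold_locales
      show "(- 1::real) = 1 \<or> (- 1::real) = - 1" by simp
      show "\<exists>\<delta>\<^sub>1>0. \<forall>\<delta>\<in>{0<..\<delta>\<^sub>1}. complex_of_real \<mu>\<^sub>0 + of_real (- 1 * \<delta>) \<in> resolvent_set D A \<and>
          strongly_positive_vec u (- 1 *\<^sub>R resolvent D A (complex_of_real \<mu>\<^sub>0 + of_real (- 1 * \<delta>)) f)"
        if "0 < f" for f
        using ev that by (rule resolvent_ev_strongly_negative_shift)
    qed (rule m U assms(4))+
    show ?thesis by (rule spectral_projection_strongly_positive)
  qed
qed

end
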